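(* Let $\kappa>0$, $D_\kappa=\pi/\sqrt{\kappa}$, and let $(M,d)$ be a complete $\mathrm{CAT}(\kappa)$ space with $\operatorname{diam}(M)<D_\kappa/2$. Let $A$ and $B$ be non-empty closed convex subsets of $M$ with $A\cap B\neq\emptyset$. Let $x_0\in M$ and let $\{x_n\}_{n\ge0}$ be the alternating projection sequence $x_{2n-1}=P_A(x_{2n-2})$, $x_{2n}=P_B(x_{2n-1})$ for $n\in\mathbb{N}=\{1,2,\dots\}$. If $A$ or $B$ is boundedly compact, then $\{x_n\}$ converges (in the metric $d$) to a point $x\in A\cap B$.
   Context: A geodesic joining $x,y$ in a metric space $(M,d)$ is a map $\gamma:[0,1]\to M$ with $\gamma(0)=x$, $\gamma(1)=y$ and $d(\gamma(s),\gamma(t))=d(x,y)|s-t|$ for all $s,t\in[0,1]$. For $\kappa>0$ put $D_\kappa=\pi/\sqrt{\kappa}$, and let $M_\kappa^2$ be the unit 2-sphere with its angular metric multiplied by $1/\sqrt{\kappa}$. $(M,d)$ is a $\mathrm{CAT}(\kappa)$ space if any two points at distance less than $D_\kappa$ are joined by a geodesic and, for every geodesic triangle of perimeter less than $2D_\kappa$, the distance between any two points of the triangle is at most the distance between the corresponding comparison points in the comparison triangle (same side lengths) in $M_\kappa^2$. A subset $C\subseteq M$ is convex if any two points of $C$ can be joined by a geodesic in $M$ and the image of every such geodesic is contained in $C$. $\operatorname{diam}(M)=\sup\{d(x,y):x,y\in M\}$ and $d(x,C)=\inf\{d(x,c):c\in C\}$. If $(M,d)$ is a complete $\mathrm{CAT}(\kappa)$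 space with $\operatorname{diam}(M)<D_\kappa/2$ and $C\subseteq M$ is non-empty, closed and convex, then for each $x\in M$ there is a unique point $P_C(x)\in C$ with $d(x,P_C(x))=d(x,C)$; $P_C$ is called the metric projection onto $C$. A metric space is boundedly compact if each of its bounded and closed subsets is compact; this is applied to $A$ or $B$ with the metric induced from $M$. *)

theory Defs
  imports "HOL-Analysis.Analysis"
begin

definition geodesic_in :: "'a set \<Rightarrow> ('a \<Rightarrow> 'a \<Rightarrow> real) \<Rightarrow> (real \<Rightarrow> 'a) \<Rightarrow> 'a \<Rightarrow> 'a \<Rightarrow> bool" where
  "geodesic_in M d g x y \<longleftrightarrow>
     g \<in> {0..1} \<rightarrow> M \<and> g 0 = x \<and> g 1 = y \<and>
     (\<forall>s\<in>{0..1}. \<forall>t\<in>{0..1}. d (g s) (g t) = d x y * \<bar>s - t\<bar>)"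

definition D_model :: "real \<Rightarrow> real" where
  "D_model \<kappa> = pi / sqrt \<kappa>"

abbreviation model_space :: "(real ^ 3) set" where
  "model_space \<equiv> sphere 0 1"

definition model_dist :: "real \<Rightarrow> real ^ 3 \<Rightarrow> real ^ 3 \<Rightarrow> real" where
  "model_dist \<kappa> x y = arccos (x \<bullet> y) / sqrt \<kappa>"

text \<open>The vertices and sides of a triangle are indexed by the three-element type
  \<^typ>\<open>3\<close>, whose addition is modulo 3; side \<open>i\<close> runs from vertex \<open>i\<close> to vertex \<open>i + 1\<close>.\<close>

definition geodesic_triangle ::
  "'a set \<Rightarrow> ('a \<Rightarrow> 'a \<Rightarrow> real) \<Rightarrow> (3 \<Rightarrow> 'a) \<Rightarrow> (3 \<Rightarrow> real \<Rightarrow> 'a) \<Rightarrow> bool" where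
  "geodesic_triangle M d v g \<longleftrightarrow> (\<forall>i. geodesic_in M d (g i) (v i) (v (i + 1)))"

definition perimeter :: "('a \<Rightarrow> 'a \<Rightarrow> real) \<Rightarrow> (3 \<Rightarrow> 'a) \<Rightarrow> real" where
  "perimeter d v = (\<Sum>i\<in>UNIV. d (v i) (v (i + 1)))"

definition comparison_triangle ::
  "real \<Rightarrow> ('a \<Rightarrow> 'a \<Rightarrow> real) \<Rightarrow> (3 \<Rightarrow> 'a) \<Rightarrow> (3 \<Rightarrow> real ^ 3) \<Rightarrow> (3 \<Rightarrow> real \<Rightarrow> real ^ 3) \<Rightarrow> bool" where
  "comparison_triangle \<kappa> d v v' g' \<longleftrightarrow>
     geodesic_triangle model_space (model_dist \<kappa>) v' g' \<and>
     (\<forall>i. model_dist \<kappa> (v' i) (v' (i + 1)) = d (v i) (v (i + 1)))"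

text \<open>Since corresponding sides have equal length and geodesics are parametrised
  proportionally to arc length, the comparison point of \<open>g i s\<close> is \<open>g' i s\<close>.\<close>

definition CAT :: "real \<Rightarrow> 'a set \<Rightarrow> ('a \<Rightarrow> 'a \<Rightarrow> real) \<Rightarrow> bool" where
  "CAT \<kappa> M d \<longleftrightarrow>
     (\<forall>x\<in>M. \<forall>y\<in>M. d x y < D_model \<kappa> \<longrightarrow> (\<exists>g. geodesic_in M d g x y)) \<and>
     (\<forall>v g v' g'. geodesic_triangle M d v g \<longrightarrow> perimeter d v < 2 * D_model \<kappa> \<longrightarrow>
        comparison_triangle \<kappa> d v v' g' \<longrightarrow>
        (\<forall>i j. \<forall>s\<in>{0..1}. \<forall>t\<in>{0..1}.
           d (g i s) (g j t) \<le> model_dist \<kappa> (g' i s) (g' j t)))"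

definition geodesically_convex :: "'a::metric_space set \<Rightarrow> bool" where
  "geodesically_convex C \<longleftrightarrow>
     (\<forall>x\<in>C. \<forall>y\<in>C. (\<exists>g. geodesic_in UNIV dist g x y) \<and>
        (\<forall>g. geodesic_in UNIV dist g x y \<longrightarrow> g ` {0..1} \<subseteq> C))"

definition metric_proj :: "'a::metric_space set \<Rightarrow> 'a \<Rightarrow> 'a" where
  "metric_proj C x = (THE p. p \<in> C \<and> dist x p = infdist x C)"

definition boundedly_compact :: "'a::metric_space set \<Rightarrow> bool" where
  "boundedly_compact X \<longleftrightarrow>
     (\<forall>S. bounded S \<and> closedin (top_of_set X) S \<longrightarrow> compact S)"

end

theory Submission
  imports Defs
begin

text \<open>
  Rescale the metric by \<open>\<surd>\<kappa>\<close>, so that the model space is the unit sphere and, by the bound on the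
  diameter, every distance lies in \<open>[0, \<pi>/2)\<close>, where the cosine is positive and strictly decreasing.
  On the sphere the cosine of the distance from a fixed point to a point moving along a great
  circle arc is explicit, since the arc is a linear combination of its endpoints with sine
  coefficients. The CAT inequality turns this formula into the inequality of
  \<open>CAT_cosine_inequality\<close>, and that inequality is all the geometry that the argument uses.

  Applied at the midpoint of two points of a convex set \<open>C\<close> it shows that almost nearest points of
  \<open>C\<close> are close together; this gives the metric projection by completeness. Applied near the
  endpoint \<open>p = P\<^sub>C(x)\<close> of a geodesic inside \<open>C\<close>, it says to first order that the angle at \<open>p\<close> is
  not acute, which in spherical form reads
  \<open>cos d(x, c) \<le> cos d(x, p) \<sqdot> cos d(p, c)\<close> for \<open>c \<in> C\<close>
  (\<open>spherical_Pythagoras_projection\<close>).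

  Let \<open>z \<in> A \<inter> B\<close>. The last inequality with \<open>c = z\<close> shows that \<open>cos d(x\<^sub>n, z)\<close> increases along
  alternating projections, so it has a limit, which is positive; then \<open>cos d(x\<^sub>n, x\<^bsub>n+1\<^esub>)\<close>,
  bounded below by the ratio of consecutive terms, tends to \<open>1\<close>. So consecutive points
  approach each other and the distance to every point of \<open>A \<inter> B\<close> is nonincreasing. The
  boundedly compact set is compact because the space is bounded, so a subsequence lying in it
  converges to some \<open>l\<close>; the points following it lie in the other set and have the same limit, so \<open>l \<in> A \<inter> B\<close>, and monotonicity of
  the distance to \<open>l\<close> gives convergence of the whole sequence.
\<close>

section \<open>Great circle arcs and triangles on the unit sphere\<close>

text \<open>Spherical linear interpolation; \<open>\<theta>\<close> is meant to be the angle between \<open>u\<close> and \<open>w\<close>. Keeping \<open>\<theta>\<close> as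
  a parameter avoids an inverse cosine in every computation.\<close>

definition great_arc :: "real \<Rightarrow> real ^ 3 \<Rightarrow> real ^ 3 \<Rightarrow> real \<Rightarrow> real ^ 3" where
  "great_arc \<theta> u w t = (1 / sin \<theta>) *\<^sub>R (sin ((1 - t) * \<theta>) *\<^sub>R u + sin (t * \<theta>) *\<^sub>R w)"

text \<open>With \<open>S r = sin (r\<theta>)\<close> and \<open>C r = cos (r\<theta>)\<close> the coefficient of \<open>u\<close> is
  \<open>sin \<theta> \<sqdot> C r - cos \<theta> \<sqdot> S r\<close>. In the expanded inner product the mixed terms \<open>C s \<sqdot> S t\<close> cancel, and
  \<open>1 - cos\<^sup>2 \<theta> = sin\<^sup>2 \<theta>\<close> leaves the addition formula for \<open>cos (s\<theta> - t\<theta>)\<close>. In particular \<open>s = t\<close>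
  shows that the arc stays on the sphere.\<close>

lemma great_arc_inner:
  assumes "norm u = 1" and "norm w = 1" and uw: "u \<bullet> w = cos \<theta>" and nz: "sin \<theta> \<noteq> 0"
  shows "great_arc \<theta> u w s \<bullet> great_arc \<theta> u w t = cos (\<theta> * (s - t))"
proof -
  have uu: "u \<bullet> u = 1" "w \<bullet> w = 1" "w \<bullet> u = cos \<theta>"
    using assms by (simp_all add: norm_eq_1 inner_commute)
  define S where "S = (\<lambda>r. sin (r * \<theta>))"
  define C where "C = (\<lambda>r. cos (r * \<theta>))"
  have arg: "sin (r * \<theta>) = S r" for r by (simp add: S_def)
  have rev: "sin ((1 - r) * \<theta>) = sin \<theta> * C r - cos \<theta> * S r" for r
    by (simp add: S_def C_def left_diff_distrib sin_diff)
  have bilinear: "(\<alpha> *\<^sub>R u + \<beta> *\<^sub>R w) \<bullet> (\<gamma> *\<^sub>R u + \<delta> *\<^sub>R w)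
      = \<alpha> * \<gamma> + \<beta> * \<delta> + cos \<theta> * (\<alpha> * \<delta> + \<beta> * \<gamma>)" for \<alpha> \<beta> \<gamma> \<delta>
    by (simp add: inner_add_left inner_add_right uu uw algebra_simps)
  have diff: "cos (\<theta> * (s - t)) = C s * C t + S s * S t"
    by (simp add: S_def C_def right_diff_distrib cos_diff mult.commute)
  have "great_arc \<theta> u w s \<bullet> great_arc \<theta> u w t =
    ((sin \<theta> * C s - cos \<theta> * S s) * (sin \<theta> * C t - cos \<theta> * S t) + S s * S t
      + cos \<theta> * ((sin \<theta> * C s - cos \<theta> * S s) * S t + S s * (sin \<theta> * C t - cos \<theta> * S t)))
     / (sin \<theta>)\<^sup>2"
    unfolding great_arc_def rev unfolding arg
    by (simp add: bilinear power2_eq_square)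
  also have "\<dots> = ((sin \<theta>)\<^sup>2 * (C s * C t) + (1 - (cos \<theta>)\<^sup>2) * (S s * S t)) / (sin \<theta>)\<^sup>2"
    by (rule arg_cong2[where f = "(/)"]) (simp_all add: power2_eq_square algebra_simps)
  also have "\<dots> = C s * C t + S s * S t"
    using nz by (simp add: sin_squared_eq[symmetric] add_divide_distrib)
  finally show ?thesis by (simp add: diff)
qed

lemma great_arc_inner_right:
  "great_arc \<theta> u w t \<bullet> z = (sin ((1 - t) * \<theta>) * (u \<bullet> z) + sin (t * \<theta>) * (w \<bullet> z)) / sin \<theta>"
  by (simp add: great_arc_def inner_add_left)

lemma geodesic_great_arc:
  assumes "\<kappa> > 0" and u: "norm u = 1" and w: "norm w = 1" and uw: "u \<bullet> w = cos \<theta>"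
    and \<theta>: "0 < \<theta>" "\<theta> < pi"
  shows "geodesic_in model_space (model_dist \<kappa>) (great_arc \<theta> u w) u w"
proof -
  have nz: "sin \<theta> \<noteq> 0" using sin_gt_zero[OF \<theta>] by simp
  note inner = great_arc_inner[OF u w uw nz]
  have "norm (great_arc \<theta> u w t) = 1" for t
    using inner[of t t] by (simp add: norm_eq_1)
  moreover have "great_arc \<theta> u w 0 = u" "great_arc \<theta> u w 1 = w"
    using nz by (simp_all add: great_arc_def)
  moreover have "arccos (great_arc \<theta> u w s \<bullet> great_arc \<theta> u w t) = \<theta> * \<bar>s - t\<bar>"
    if "s \<in> {0..1}" "t \<in> {0..1}" for s t
  proof -
    have "\<theta> * \<bar>s - t\<bar> \<le> \<theta> * 1" using that \<theta> by (intro mult_left_mono) auto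
    then have "\<theta> * \<bar>s - t\<bar> \<le> pi" using \<theta> by linarith
    then have "arccos (cos (\<theta> * \<bar>s - t\<bar>)) = \<theta> * \<bar>s - t\<bar>"
      using \<theta> by (intro arccos_cos) auto
    moreover have "cos (\<theta> * \<bar>s - t\<bar>) = cos (\<theta> * (s - t))"
      using \<theta> cos_abs_real[of "\<theta> * (s - t)"] by (simp add: abs_mult)
    ultimately show ?thesis by (simp add: inner)
  qed
  moreover have "arccos (u \<bullet> w) = \<theta>" using \<theta> by (simp add: uw arccos_cos)
  ultimately show ?thesis
    by (auto simp: geodesic_in_def model_dist_def)
qed

text \<open>Degenerate sides have to be covered too, because comparison triangles of degenerate
  triangles occur below; for \<open>\<theta> = 0\<close> the great arc collapses to the zero
  vector, and the constant path takes its place.\<close>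

lemma geodesic_on_sphere_exists:
  assumes "\<kappa> > 0" and u: "norm u = 1" and w: "norm w = 1" and uw: "u \<bullet> w = cos \<theta>"
    and \<theta>: "0 \<le> \<theta>" "\<theta> < pi"
  shows "\<exists>g. geodesic_in model_space (model_dist \<kappa>) g u w"
proof (cases "\<theta> = 0")
  case True
  have uu: "u \<bullet> u = 1" "w \<bullet> w = 1" using u w by (simp_all add: norm_eq_1)
  have "(u - w) \<bullet> (u - w) = 0"
    using uw uu True by (simp add: inner_diff_left inner_diff_right inner_commute)
  then have "w = u" by simp
  then have "geodesic_in model_space (model_dist \<kappa>) (\<lambda>_. u) u w"
    using u uu by (auto simp: geodesic_in_def model_dist_def)
  then show ?thesis by blast
next
  case False
  then show ?thesis using geodesic_great_arc[OF assms(1-4)] \<theta> by auto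
qed

text \<open>Put \<open>u\<close> at the first basis vector and \<open>v\<close> in the first coordinate plane. The two
  prescribed inner products fix the first two coordinates of \<open>w\<close>; what is left of its length for the
  third is nonnegative because \<open>cos (a + b) \<le> cos c \<le> cos (a - b)\<close>, which is the triangle inequality.
  Only the side \<open>a\<close> must be nondegenerate, as it serves as the base.\<close>

lemma spherical_triangle_exists:
  fixes a b c :: real
  assumes a: "0 < a" and c: "\<bar>a - b\<bar> \<le> c" "c \<le> a + b" and ab: "a + b \<le> pi"
    and a': "a < pi"
  obtains u v w :: "real ^ 3"
  where "norm u = 1" "norm v = 1" "norm w = 1"
    "u \<bullet> v = cos a" "u \<bullet> w = cos b" "v \<bullet> w = cos c"
proof -
  have sa: "sin a > 0" using a a' by (rule sin_gt_zero)
  define h where "h = (cos c - cos a * cos b) / sin a"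
  have "cos (a + b) \<le> cos c" using c ab by (intro cos_monotone_0_pi_le) auto
  moreover have "cos c \<le> cos \<bar>a - b\<bar>" using c ab by (intro cos_monotone_0_pi_le) auto
  ultimately have "\<bar>cos c - cos a * cos b\<bar> \<le> sin a * sin b"
    by (simp add: cos_add cos_diff abs_le_iff)
  then have "\<bar>h\<bar> \<le> sin b" using sa by (simp add: h_def abs_divide divide_le_eq mult.commute)
  then have "h\<^sup>2 \<le> (sin b)\<^sup>2" by (simp add: abs_le_square_iff[symmetric])
  then have r: "(sqrt ((sin b)\<^sup>2 - h\<^sup>2))\<^sup>2 = (sin b)\<^sup>2 - h\<^sup>2" by simp
  define u v w :: "real ^ 3" where "u = vector [1, 0, 0]"
    and "v = vector [cos a, sin a, 0]"
    and "w = vector [cos b, h, sqrt ((sin b)\<^sup>2 - h\<^sup>2)]"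
  note vec = u_def v_def w_def norm_eq_1 inner_vec_def sum_3 vector_3
  show thesis
  proof
    show "norm u = 1" "norm v = 1" "u \<bullet> v = cos a" "u \<bullet> w = cos b"
      by (simp_all add: vec power2_eq_square[symmetric])
    show "norm w = 1" using r by (simp add: vec power2_eq_square[symmetric])
    show "v \<bullet> w = cos c" using sa by (simp add: vec h_def)
  qed
qed

section \<open>CAT spaces of small diameter\<close>

text \<open>In the index type \<open>3\<close> the successor of \<open>3\<close> is \<open>1\<close>, so the side starting at \<open>c\<close> ends at \<open>a\<close>.\<close>

definition tri :: "'b \<Rightarrow> 'b \<Rightarrow> 'b \<Rightarrow> 3 \<Rightarrow> 'b" where
  "tri a b c i = (if i = 1 then a else if i = 2 then b else c)"

text \<open>The parameter \<open>ty\<close> only names the type whose whole universe is the space.\<close>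

locale small_CAT =
  fixes \<kappa> :: real and ty :: "'a::complete_space itself"
  assumes kappa: "\<kappa> > 0"
    and CAT: "CAT \<kappa> (UNIV :: 'a set) dist"
    and bounded: "bounded (UNIV :: 'a set)"
    and diam: "diameter (UNIV :: 'a set) < D_model \<kappa> / 2"
begin

text \<open>Distance after rescaling to curvature bound \<open>1\<close>; it takes values in \<open>[0, \<pi>/2)\<close>.\<close>

definition ang :: "'a \<Rightarrow> 'a \<Rightarrow> real" where
  "ang x y = sqrt \<kappa> * dist x y"

lemma ang_nonneg [simp]: "0 \<le> ang x y"
  and ang_refl [simp]: "ang x x = 0"
  and ang_commute: "ang x y = ang y x"
  and ang_triangle: "ang x z \<le> ang x y + ang y z"
  and ang_eq_0_iff [simp]: "ang x y = 0 \<longleftrightarrow> x = y"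
  using kappa dist_triangle[of x z y]
  by (auto simp: ang_def dist_commute distrib_left[symmetric])

lemma dist_eq_ang: "dist x y = ang x y / sqrt \<kappa>"
  using kappa by (simp add: ang_def)

lemma ang_le_iff: "ang x y \<le> ang z w \<longleftrightarrow> dist x y \<le> dist z w"
  using kappa by (simp add: ang_def)

lemma dist_less: "dist (x::'a) y < D_model \<kappa> / 2"
  using diameter_bounded_bound[OF bounded, of x y] diam by simp

lemma ang_less: "ang x y < pi / 2"
  using dist_less[of x y] kappa by (simp add: ang_def D_model_def field_simps)

lemma ang_le_pi [simp]: "ang x y \<le> pi"
  using ang_less[of x y] ang_nonneg[of x y] by linarith

lemma arccos_cos_ang [simp]: "arccos (cos (ang x y)) = ang x y"
  by (simp add: arccos_cos)

lemma cos_ang_pos: "0 < cos (ang x y)"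
  by (rule cos_gt_zero_pi) (use ang_less[of x y] ang_nonneg[of x y] pi_gt_zero in linarith)+

lemma cos_ang_le_iff: "cos (ang x y) \<le> cos (ang z w) \<longleftrightarrow> dist z w \<le> dist x y"
  by (simp add: cos_mono_le_eq ang_le_iff)

text \<open>In the comparison triangle with vertices \<open>u\<close>, \<open>v\<close>, \<open>w\<close> for \<open>p\<close>, \<open>c\<close>, \<open>x\<close>, the comparison point
  of \<open>g t\<close> lies on the great arc from \<open>u\<close> to \<open>v\<close>, and for it the claim holds with
  equality, by linearity of the inner product with \<open>w\<close>. The CAT condition says that \<open>g t\<close> is no farther from \<open>x\<close> than the comparison point is
  from \<open>w\<close>, that is, the cosine of the distance is no smaller.\<close>

lemma CAT_cosine_inequality:
  fixes x p c :: 'a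
  assumes g: "geodesic_in UNIV dist g p c" and t: "t \<in> {0..1}"
  shows "sin ((1 - t) * ang p c) * cos (ang x p) + sin (t * ang p c) * cos (ang x c)
    \<le> sin (ang p c) * cos (ang x (g t))"
proof (cases "p = c")
  case True
  then show ?thesis by simp
next
  case False
  then have pos: "0 < ang p c" using ang_nonneg[of p c] by (simp add: less_le del: ang_nonneg)
  have lt: "ang y z < pi" for y z using ang_less[of y z] ang_nonneg[of y z] by linarith
  obtain u v w :: "real ^ 3" where uvw: "norm u = 1" "norm v = 1" "norm w = 1"
    "u \<bullet> v = cos (ang p c)" "u \<bullet> w = cos (ang p x)" "v \<bullet> w = cos (ang c x)"
  proof (rule spherical_triangle_exists[of "ang p c" "ang p x" "ang c x"])
    show "\<bar>ang p c - ang p x\<bar> \<le> ang c x"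
      using ang_triangle[of p c x] ang_triangle[of p x c] by (simp add: ang_commute)
    show "ang c x \<le> ang p c + ang p x"
      using ang_triangle[of c x p] by (simp add: ang_commute)
    show "ang p c + ang p x \<le> pi" using ang_less[of p c] ang_less[of p x] by simp
  qed (use pos lt in auto)
  let ?G = "geodesic_in model_space (model_dist \<kappa>)"
  have g0': "?G (great_arc (ang p c) u v) u v"
    using uvw pos lt by (intro geodesic_great_arc kappa) auto
  obtain g1' where g1': "?G g1' v w"
    using geodesic_on_sphere_exists[OF kappa uvw(2,3,6)] lt by auto
  obtain g2' where g2': "?G g2' w u"
    using geodesic_on_sphere_exists[OF kappa uvw(3,1), of "ang p x"] uvw(5) lt
    by (auto simp: inner_commute)
  have D: "D_model \<kappa> > 0" using kappa by (simp add: D_model_def)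
  have ex: "\<exists>h. geodesic_in UNIV dist h y z" for y z :: 'a
    using CAT dist_less[of y z] D unfolding CAT_def by auto
  obtain g1 g2 where g1: "geodesic_in UNIV dist g1 c x" and g2: "geodesic_in UNIV dist g2 x p"
    using ex by blast
  let ?v = "tri p c x" and ?g = "tri g g1 g2"
  let ?v' = "tri u v w" and ?g' = "tri (great_arc (ang p c) u v) g1' g2'"
  have "geodesic_triangle UNIV dist ?v ?g"
    using g g1 g2 by (simp add: geodesic_triangle_def forall_3 tri_def)
  moreover have "perimeter dist ?v < 2 * D_model \<kappa>"
    using dist_less[of p c] dist_less[of c x] dist_less[of x p] D
    by (simp add: perimeter_def sum_3 tri_def)
  moreover have "comparison_triangle \<kappa> dist ?v ?v' ?g'"
  proof -
    have "model_dist \<kappa> u v = dist p c" "model_dist \<kappa> v w = dist c x" "model_dist \<kappa> w u = dist x p"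
      using uvw lt
      by (simp_all add: model_dist_def dist_eq_ang arccos_cos inner_commute ang_commute)
    then show ?thesis
      using g0' g1' g2'
      by (simp add: comparison_triangle_def geodesic_triangle_def forall_3 tri_def)
  qed
  ultimately have le: "dist (?g 1 t) (?g 2 1) \<le> model_dist \<kappa> (?g' 1 t) (?g' 2 1)"
    using CAT t unfolding CAT_def by (meson atLeastAtMost_iff order_refl zero_le_one)
  \<comment> \<open>The vertex \<open>x\<close> enters the CAT inequality as the endpoint of the second side.\<close>
  have "?g 2 1 = x" "?g' 2 1 = w"
    using g1 g1' by (simp_all add: tri_def geodesic_in_def)
  then have le': "ang x (g t) \<le> arccos (great_arc (ang p c) u v t \<bullet> w)"
    using le kappa by (simp add: tri_def model_dist_def ang_def dist_commute field_simps)
  have "norm (great_arc (ang p c) u v t) = 1"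
    using g0' t by (auto simp: geodesic_in_def)
  then have bound: "\<bar>great_arc (ang p c) u v t \<bullet> w\<bar> \<le> 1"
    using Cauchy_Schwarz_ineq2[of "great_arc (ang p c) u v t" w] uvw by simp
  have "great_arc (ang p c) u v t \<bullet> w = cos (arccos (great_arc (ang p c) u v t \<bullet> w))"
    using bound by (simp add: cos_arccos_abs)
  also have "\<dots> \<le> cos (ang x (g t))"
    using le' bound by (intro cos_monotone_0_pi_le) (auto simp: arccos_ubound abs_le_iff)
  finally show ?thesis
    using uvw sin_gt_zero[OF pos lt]
    by (simp add: great_arc_inner_right divide_le_eq ang_commute mult.commute)
qed

section \<open>The metric projection onto a closed convex set\<close>

lemma scaled_infdist_nonneg: "0 \<le> sqrt \<kappa> * infdist (x::'a) C"
  using kappa infdist_nonneg[of x C] by (intro mult_nonneg_nonneg) auto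

lemma scaled_infdist_less: "C \<noteq> {} \<Longrightarrow> sqrt \<kappa> * infdist (x::'a) C < pi / 2"
proof -
  assume "C \<noteq> {}"
  then obtain c where "c \<in> C" by blast
  then have "infdist x C \<le> dist x c" by (rule infdist_le)
  then have "sqrt \<kappa> * infdist x C \<le> ang x c" using kappa by (simp add: ang_def)
  then show ?thesis using ang_less[of x c] by simp
qed

lemma cos_ang_le_infdist:
  assumes "c \<in> C"
  shows "cos (ang x c) \<le> cos (sqrt \<kappa> * infdist x C)"
proof (rule cos_monotone_0_pi_le)
  show "sqrt \<kappa> * infdist x C \<le> ang x c"
    using kappa infdist_le[OF assms, of x] by (simp add: ang_def)
  show "ang x c \<le> pi" using ang_less[of x c] ang_nonneg[of x c] by linarith
  show "0 \<le> sqrt \<kappa> * infdist x C" by (rule scaled_infdist_nonneg)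
qed

text \<open>Quantitative uniform convexity: the midpoint of \<open>p\<close> and \<open>c\<close> lies in \<open>C\<close>, so it is at
  least as far from \<open>x\<close> as the infimum. When \<open>p\<close> and \<open>c\<close> are both almost nearest to \<open>x\<close>, the
  inequality forces \<open>cos (ang p c / 2)\<close> to be close to \<open>1\<close>. It is
  \<open>CAT_cosine_inequality\<close> at \<open>t = 1/2\<close>, divided by \<open>sin (ang p c / 2)\<close>.\<close>

lemma midpoint_inequality:
  assumes conv: "geodesically_convex C" and p: "p \<in> C" and c: "c \<in> C"
  shows "cos (ang x p) + cos (ang x c) \<le> 2 * cos (sqrt \<kappa> * infdist x C) * cos (ang p c / 2)"
proof (cases "p = c")
  case True
  then show ?thesis using cos_ang_le_infdist[OF c, of x] by simp
next
  case False
  then have pos: "0 < ang p c" using ang_nonneg[of p c] by (simp add: less_le del: ang_nonneg)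
  obtain g where g: "geodesic_in UNIV dist g p c" and sub: "g ` {0..1} \<subseteq> C"
    using conv p c unfolding geodesically_convex_def by blast
  define h where "h = ang p c / 2"
  have sh: "sin h > 0" using pos ang_less[of p c] by (intro sin_gt_zero) (auto simp: h_def)
  have "sin h * (cos (ang x p) + cos (ang x c)) \<le> sin (2 * h) * cos (ang x (g (1/2)))"
    using CAT_cosine_inequality[OF g, of "1/2" x] by (simp add: h_def distrib_left)
  also have "\<dots> = sin h * (2 * cos h * cos (ang x (g (1/2))))"
    by (simp add: sin_double)
  finally have "cos (ang x p) + cos (ang x c) \<le> 2 * cos h * cos (ang x (g (1/2)))"
    using sh by simp
  also have "\<dots> \<le> 2 * cos h * cos (sqrt \<kappa> * infdist x C)"
  proof (rule mult_left_mono[OF cos_ang_le_infdist])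
    show "g (1/2) \<in> C" using sub by force
    show "0 \<le> 2 * cos h"
      using pos ang_less[of p c] by (simp add: h_def cos_ge_zero)
  qed
  finally show ?thesis by (simp add: h_def mult_ac)
qed

text \<open>By \<open>midpoint_inequality\<close> every minimizing sequence is Cauchy.\<close>

lemma projection_exists:
  fixes x :: 'a
  assumes ne: "C \<noteq> {}" and cl: "closed C" and conv: "geodesically_convex C"
  shows "\<exists>p\<in>C. dist x p = infdist x C"
proof -
  define K where "K = cos (sqrt \<kappa> * infdist x C)"
  have K: "K > 0"
    unfolding K_def
    by (rule cos_gt_zero_pi)
      (use scaled_infdist_less[OF ne, of x] scaled_infdist_nonneg[of x C] pi_gt_zero in linarith)+
  have "\<exists>y\<in>C. dist x y < infdist x C + 1 / real (Suc n)" for n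
    using cINF_less_iff[OF ne bdd_below_image_dist, of x "infdist x C + 1 / real (Suc n)"] ne
    by (simp add: infdist_notempty)
  then obtain y where y: "\<And>n. y n \<in> C" "\<And>n. dist x (y n) < infdist x C + 1 / real (Suc n)"
    by metis
  have d: "(\<lambda>n. dist x (y n)) \<longlonglongrightarrow> infdist x C"
  proof (rule tendsto_sandwich[OF _ _ tendsto_const])
    show "\<forall>\<^sub>F n in sequentially. infdist x C \<le> dist x (y n)"
      using y(1) by (simp add: infdist_le)
    show "\<forall>\<^sub>F n in sequentially. dist x (y n) \<le> infdist x C + 1 / real (Suc n)"
      using y(2) by (intro always_eventually allI less_imp_le)
    show "(\<lambda>n. infdist x C + 1 / real (Suc n)) \<longlonglongrightarrow> infdist x C"
      using tendsto_add[OF tendsto_const LIMSEQ_Suc[OF lim_1_over_n], of "infdist x C"] by simp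
  qed
  then have a: "(\<lambda>n. cos (ang x (y n))) \<longlonglongrightarrow> K"
    unfolding K_def ang_def by (intro tendsto_intros)
  have "Cauchy y"
  proof (rule metric_CauchyI)
    fix e :: real assume e: "e > 0"
    \<comment> \<open>The cap at \<open>pi\<close> keeps \<open>\<epsilon>\<close> in the range where the cosine is decreasing.\<close>
    define \<epsilon> where "\<epsilon> = min (sqrt \<kappa> * e / 2) pi"
    have \<epsilon>: "0 < \<epsilon>" "\<epsilon> \<le> pi" "\<epsilon> \<le> sqrt \<kappa> * e / 2" using e kappa by (auto simp: \<epsilon>_def)
    have "cos \<epsilon> < cos 0" using \<epsilon> by (intro cos_monotone_0_pi) auto
    then have "K * cos \<epsilon> < K" using K by simp
    then have "\<forall>\<^sub>F n in sequentially. K * cos \<epsilon> < cos (ang x (y n))"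
      by (rule order_tendstoD(1)[OF a])
    then obtain N where N: "\<And>n. n \<ge> N \<Longrightarrow> K * cos \<epsilon> < cos (ang x (y n))"
      unfolding eventually_sequentially by blast
    have "dist (y m) (y n) < e" if "m \<ge> N" "n \<ge> N" for m n
    proof (rule ccontr)
      assume "\<not> dist (y m) (y n) < e"
      then have "\<epsilon> \<le> ang (y m) (y n) / 2"
        using \<epsilon>(3) mult_left_mono[of e "dist (y m) (y n)" "sqrt \<kappa>"] real_sqrt_ge_zero[of \<kappa>] kappa
        unfolding ang_def by linarith
      then have "cos (ang (y m) (y n) / 2) \<le> cos \<epsilon>"
        using \<epsilon>(1) ang_less[of "y m" "y n"] by (intro cos_monotone_0_pi_le) auto
      then have "2 * K * cos (ang (y m) (y n) / 2) \<le> 2 * K * cos \<epsilon>"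
        using K by simp
      then show False
        using midpoint_inequality[OF conv y(1)[of m] y(1)[of n], of x] N[OF that(1)] N[OF that(2)]
        by (simp add: K_def)
    qed
    then show "\<exists>N. \<forall>m\<ge>N. \<forall>n\<ge>N. dist (y m) (y n) < e" by blast
  qed
  then obtain p where p: "y \<longlonglongrightarrow> p" using Cauchy_convergent convergent_def by blast
  then have "p \<in> C" using cl y(1) closed_sequentially by blast
  moreover have "dist x p = infdist x C"
    using LIMSEQ_unique[OF tendsto_dist[OF tendsto_const p] d] .
  ultimately show ?thesis by blast
qed

lemma projection_unique:
  fixes x :: 'a
  assumes conv: "geodesically_convex C"
    and p: "p \<in> C" "dist x p = infdist x C" and q: "q \<in> C" "dist x q = infdist x C"
  shows "p = q"
proof -
  have "cos (ang x p) \<le> cos (ang x p) * cos (ang p q / 2)"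
    using midpoint_inequality[OF conv p(1) q(1), of x] p q by (simp add: ang_def)
  then have "cos 0 \<le> cos (ang p q / 2)" using cos_ang_pos[of x p] by simp
  then have "ang p q / 2 \<le> 0"
    using cos_mono_le_eq[of 0 "ang p q / 2"] ang_less[of p q] pi_gt_zero by simp
  then show ?thesis using ang_nonneg[of p q] ang_eq_0_iff[of p q] by linarith
qed

lemma metric_proj_in:
  fixes x :: 'a
  assumes "C \<noteq> {}" and "closed C" and conv: "geodesically_convex C"
  shows "metric_proj C x \<in> C" and dist_metric_proj: "dist x (metric_proj C x) = infdist x C"
proof -
  have "\<exists>!p. p \<in> C \<and> dist x p = infdist x C"
    using projection_exists[OF assms, of x] projection_unique[OF conv] by blast
  from theI'[OF this]
  show "metric_proj C x \<in> C" and "dist x (metric_proj C x) = infdist x C"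
    unfolding metric_proj_def by auto
qed

text \<open>The function \<open>f\<close> below is the left-hand side of \<open>CAT_cosine_inequality\<close> along a geodesic in \<open>C\<close>
  from the projection \<open>p\<close> to \<open>c\<close>. As no point of \<open>C\<close> is nearer to \<open>x\<close> than \<open>p\<close>, it is bounded by
  \<open>sin \<theta> \<sqdot> cos (ang x p)\<close>, which is its value at \<open>t = 0\<close>. So its derivative at \<open>0\<close> cannot be
  positive, and this is the claim. Equality would be the Pythagorean theorem
  for a right angle at \<open>p\<close>; an obtuse angle gives the inequality.\<close>

lemma spherical_Pythagoras_projection:
  fixes x :: 'a
  assumes C: "C \<noteq> {}" "closed C" "geodesically_convex C" and c: "c \<in> C"
  shows "cos (ang x c) \<le> cos (ang x (metric_proj C x)) * cos (ang (metric_proj C x) c)"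
proof -
  define p where "p = metric_proj C x"
  have p: "p \<in> C" "dist x p = infdist x C"
    using metric_proj_in[OF C] dist_metric_proj[OF C] by (auto simp: p_def)
  show ?thesis
  proof (cases "p = c")
    case True
    then show ?thesis by (simp add: p_def[symmetric])
  next
    case False
    then have pos: "0 < ang p c" using ang_nonneg[of p c] by (simp add: less_le del: ang_nonneg)
    obtain g where g: "geodesic_in UNIV dist g p c" and sub: "g ` {0..1} \<subseteq> C"
      using C(3) p c unfolding geodesically_convex_def by blast
    define \<theta> where "\<theta> = ang p c"
    define f where "f = (\<lambda>t. sin ((1 - t) * \<theta>) * cos (ang x p) + sin (t * \<theta>) * cos (ang x c))"
    have le: "f t \<le> f 0" if t: "t \<in> {0..1}" for t
    proof -
      have "cos (ang x (g t)) \<le> cos (ang x p)"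
        using cos_ang_le_infdist[of "g t" C x] sub t p(2) unfolding ang_def by fastforce
      moreover have "0 \<le> sin \<theta>"
        using pos ang_less[of p c] by (intro sin_ge_zero) (auto simp: \<theta>_def)
      ultimately have "sin \<theta> * cos (ang x (g t)) \<le> sin \<theta> * cos (ang x p)"
        by (rule mult_left_mono)
      then show ?thesis using CAT_cosine_inequality[OF g t, of x] by (simp add: f_def \<theta>_def)
    qed
    have deriv: "(f has_real_derivative \<theta> * (cos (ang x c) - cos \<theta> * cos (ang x p))) (at 0)"
      unfolding f_def by (auto intro!: derivative_eq_intros simp: algebra_simps)
    have "\<not> 0 < \<theta> * (cos (ang x c) - cos \<theta> * cos (ang x p))"
    proof
      assume "0 < \<theta> * (cos (ang x c) - cos \<theta> * cos (ang x p))"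
      from DERIV_pos_inc_right[OF deriv this]
      obtain \<delta> where \<delta>: "\<delta> > 0" "\<And>h. 0 < h \<Longrightarrow> h < \<delta> \<Longrightarrow> f 0 < f h" by auto
      have "f 0 < f (min (\<delta> / 2) 1)" using \<delta>(1) by (intro \<delta>(2)) auto
      with le[of "min (\<delta> / 2) 1"] \<delta>(1) show False by auto
    qed
    then show ?thesis
      using pos by (simp add: \<theta>_def p_def[symmetric] zero_less_mult_iff mult.commute)
  qed
qed

lemma metric_proj_dist_le:
  fixes x :: 'a
  assumes "C \<noteq> {}" "closed C" "geodesically_convex C" and "c \<in> C"
  shows "dist (metric_proj C x) c \<le> dist x c"
proof -
  have "cos (ang x c) \<le> 1 * cos (ang (metric_proj C x) c)"
    using spherical_Pythagoras_projection[OF assms, of x] cos_ang_pos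
    by (elim order_trans) (intro mult_right_mono, auto intro: less_imp_le)
  then show ?thesis by (simp add: cos_ang_le_iff)
qed

section \<open>Alternating projections\<close>

text \<open>The sets may vary arbitrarily with \<open>n\<close> as long as they share a point \<open>z\<close>. By
  \<open>spherical_Pythagoras_projection\<close> the cosine of a step is at least the ratio of consecutive values of
  \<open>cos (ang (x n) z)\<close>, and these increase to a positive limit.\<close>

lemma alternating_projections_asymptotically_regular:
  fixes x :: "nat \<Rightarrow> 'a"
  assumes C: "\<And>n. C n \<noteq> {}" "\<And>n. closed (C n)" "\<And>n. geodesically_convex (C n)"
    and z: "\<And>n. z \<in> C n"
    and step: "\<And>n. x (Suc n) = metric_proj (C n) (x n)"
  shows "(\<lambda>n. dist (x n) (x (Suc n))) \<longlonglongrightarrow> 0"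
proof -
  define a where "a = (\<lambda>n. cos (ang (x n) z))"
  have a_le: "a n \<le> cos (ang (x n) (x (Suc n))) * a (Suc n)" for n
    using spherical_Pythagoras_projection[OF C z, of "x n"] by (simp add: a_def step)
  have "incseq a"
    by (rule incseq_SucI) (use metric_proj_dist_le[OF C z] in \<open>simp add: a_def step cos_ang_le_iff\<close>)
  moreover have "\<And>n. a n \<le> 1" by (simp add: a_def)
  ultimately obtain L where L: "a \<longlonglongrightarrow> L" and aL: "\<And>n. a n \<le> L"
    using incseq_convergent[of a 1] by blast
  have pos: "a n > 0" for n by (simp add: a_def cos_ang_pos)
  have L0: "L > 0" using pos[of 0] aL[of 0] by simp
  have "(\<lambda>n. a n / a (Suc n)) \<longlonglongrightarrow> L / L"
    using L0 by (intro tendsto_divide L LIMSEQ_Suc[OF L]) auto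
  then have ratio: "(\<lambda>n. a n / a (Suc n)) \<longlonglongrightarrow> 1" using L0 by simp
  have "(\<lambda>n. cos (ang (x n) (x (Suc n)))) \<longlonglongrightarrow> 1"
    by (rule tendsto_sandwich[OF _ _ ratio tendsto_const])
      (use a_le pos in \<open>auto simp: divide_le_eq intro!: always_eventually\<close>)
  then have "(\<lambda>n. arccos (cos (ang (x n) (x (Suc n))))) \<longlonglongrightarrow> arccos 1"
    by (rule continuous_on_tendsto_compose[OF continuous_on_arccos']) auto
  then have "(\<lambda>n. ang (x n) (x (Suc n)) / sqrt \<kappa>) \<longlonglongrightarrow> 0 / sqrt \<kappa>"
    using kappa by (intro tendsto_divide tendsto_const) auto
  then show ?thesis by (simp add: dist_eq_ang[symmetric])
qed

end

lemma Fejer_monotone_subseq_converges: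
  fixes x :: "nat \<Rightarrow> 'a::metric_space"
  assumes mono: "\<And>n. dist (x (Suc n)) l \<le> dist (x n) l"
    and r: "(x \<circ> r) \<longlonglongrightarrow> l"
  shows "x \<longlonglongrightarrow> l"
proof (rule metric_LIMSEQ_I)
  fix e :: real assume "e > 0"
  then obtain k where k: "dist (x (r k)) l < e"
    using metric_LIMSEQ_D[OF r] by fastforce
  have "dist (x n) l \<le> dist (x (r k)) l" if "n \<ge> r k" for n
    using lift_Suc_antimono_le[of "\<lambda>n. dist (x n) l", OF mono that] .
  then show "\<exists>N. \<forall>n\<ge>N. dist (x n) l < e" using k by (meson le_less_trans)
qed

lemma boundedly_compact_imp_compact:
  assumes "boundedly_compact X" "bounded X"
  shows "compact X"
  using assms by (auto simp: boundedly_compact_def)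

theorem corollary3p9:
  fixes \<kappa> :: real
    and A B :: "'a::complete_space set"
    and x :: "nat \<Rightarrow> 'a"
    and x0 :: 'a
  assumes "\<kappa> > 0"
    and "CAT \<kappa> (UNIV :: 'a set) dist"
    and "bounded (UNIV :: 'a set)"
    and "diameter (UNIV :: 'a set) < D_model \<kappa> / 2"
    and "A \<noteq> {}" and "closed A" and "geodesically_convex A"
    and "B \<noteq> {}" and "closed B" and "geodesically_convex B"
    and "A \<inter> B \<noteq> {}"
    and "x 0 = x0"
    and "\<And>n. n \<ge> 1 \<Longrightarrow> x (2 * n - 1) = metric_proj A (x (2 * n - 2))"
    and "\<And>n. n \<ge> 1 \<Longrightarrow> x (2 * n) = metric_proj B (x (2 * n - 1))"
    and "boundedly_compact A \<or> boundedly_compact B"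
  shows "\<exists>l \<in> A \<inter> B. x \<longlonglongrightarrow> l"
proof -
  interpret small_CAT \<kappa> "TYPE('a)" by unfold_locales fact+
  define C where "C = (\<lambda>n::nat. if even n then A else B)"
  have C: "C n \<noteq> {}" "closed (C n)" "geodesically_convex (C n)" for n
    using assms by (auto simp: C_def)
  have step: "x (Suc n) = metric_proj (C n) (x n)" for n
  proof (cases "even n")
    case True
    then obtain m where "n = 2 * m" by blast
    then show ?thesis using assms(13)[of "Suc m"] by (simp add: C_def)
  next
    case False
    then obtain m where "n = 2 * m + 1" using oddE by blast
    then show ?thesis using assms(14)[of "Suc m"] by (simp add: C_def)
  qed
  have inC: "x (Suc n) \<in> C n" for n using metric_proj_in[OF C] by (simp add: step)
  have Fejer: "dist (x (Suc n)) z \<le> dist (x n) z" if "z \<in> A \<inter> B" for z n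
    using metric_proj_dist_le[OF C, of z n "x n"] that by (simp add: step C_def)
  obtain z where z: "z \<in> A \<inter> B" using assms by blast
  have reg: "(\<lambda>n. dist (x n) (x (Suc n))) \<longlonglongrightarrow> 0"
    by (rule alternating_projections_asymptotically_regular[of C z, OF C _ step])
      (use z in \<open>auto simp: C_def\<close>)
  \<comment> \<open>The parity of \<open>j\<close> records which of the two sets is compact.\<close>
  obtain j :: nat where "compact (C j)"
    using assms(15) boundedly_compact_imp_compact bounded_subset[OF assms(3)]
    by (metis C_def even_zero odd_one subset_UNIV)
  moreover have Cj: "C (j + 2 * k) = C j" for k by (simp add: C_def)
  have "\<forall>k. x (Suc (j + 2 * k)) \<in> C j" using inC[of "j + 2 * k" for k] by (simp add: Cj)
  ultimately obtain l r where l: "l \<in> C j" and r: "strict_mono r"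
    and lim: "((\<lambda>k. x (Suc (j + 2 * k))) \<circ> r) \<longlonglongrightarrow> l"
    unfolding compact_def by metis
  let ?s = "\<lambda>k. Suc (j + 2 * r k)"
  have s: "strict_mono ?s" using r by (simp add: strict_mono_def)
  have lim: "(x \<circ> ?s) \<longlonglongrightarrow> l" using lim by (simp add: o_def)
  have "(\<lambda>k. dist (x (?s k)) (x (Suc (?s k)))) \<longlonglongrightarrow> 0"
    using LIMSEQ_subseq_LIMSEQ[OF reg s] by (simp add: o_def)
  \<comment> \<open>The successors of the subsequence lie in the other set and share its limit.\<close>
  from tendsto_add[OF this tendsto_dist[OF lim tendsto_const[of l]]]
  have bound: "(\<lambda>k. dist (x (?s k)) (x (Suc (?s k))) + dist (x (?s k)) l) \<longlonglongrightarrow> 0"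
    by (simp add: o_def)
  have "(\<lambda>k. dist (x (Suc (?s k))) l) \<longlonglongrightarrow> 0"
    by (rule tendsto_sandwich[OF _ _ tendsto_const bound])
      (auto intro!: always_eventually dist_triangle3)
  then have lim': "(\<lambda>k. x (Suc (?s k))) \<longlonglongrightarrow> l" by (simp add: tendsto_dist_iff[symmetric])
  have "x (Suc (?s k)) \<in> C (Suc j)" for k
    using inC[of "?s k"] by (simp add: C_def)
  then have "l \<in> C (Suc j)"
    using lim' by (rule closed_sequentially[OF C(2)])
  with l have "l \<in> A \<inter> B" by (auto simp: C_def split: if_splits)
  with Fejer_monotone_subseq_converges[OF Fejer lim] show ?thesis by blast
qed

end
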